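(* Let $u_2(T)=T+T^2+T^6\in\mathbf{F}_2[T]$. Then $$\mathcal{S}_2(u_2)=\{1\}.$$
   Context: For a polynomial $f\in\mathbf{F}_2[T]$, its finite-extension permutation spectrum is $\mathcal{S}_2(f)=\{m\in\mathbf{N}_{>0}: f\colon\mathbf{F}_{2^m}\to\mathbf{F}_{2^m}\text{ is bijective}\}$. *)

theory Defs
  imports "HOL-Algebra.Algebraic_Closure_Type" "HOL-Library.Z2"
begin

text \<open>
  The type \<^typ>\<open>bit\<close> is the field with two elements.  All its finite extensions are
  taken inside one algebraic closure: \<open>GF2 m\<close> is the set of roots of \<open>X ^ (2 ^ m) - X\<close>.
  For \<open>m > 0\<close> this is the unique subfield with \<open>2 ^ m\<close> elements; see the lemmas \<open>subfield_GF2\<close>,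
  \<open>card_GF2\<close> and \<open>GF2_unique\<close>.
\<close>

definition GF2 :: "nat \<Rightarrow> bit alg_closure set" where
  "GF2 m = {x. x ^ (2 ^ m) = x}"

definition permutation_spectrum2 :: "bit poly \<Rightarrow> nat set" where
  "permutation_spectrum2 f =
     {m. m > 0 \<and> bij_betw (\<lambda>x. poly (map_poly to_ac f) x) (GF2 m) (GF2 m)}"

definition u2 :: "bit poly" where
  "u2 = Polynomial.monom 1 1 + Polynomial.monom 1 2 + Polynomial.monom 1 6"

lemma CHAR_bit: "CHAR(bit) = 2"
proof (rule CHAR_eqI)
  have *: "(of_nat n :: bit) = of_bool (odd n)" for n
    by (induction n) auto
  show "2 dvd n" if "of_nat n = (0 :: bit)" for n
    using that by (auto simp: * split: if_splits)
qed simp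

lemma CHAR_bit_closure: "CHAR(bit alg_closure) = 2"
  by (simp add: CHAR_bit)

lemma two_eq_0_bit_closure: "(2 :: bit alg_closure) = 0"
  using of_nat_CHAR[where ?'a = "bit alg_closure"] by (simp add: CHAR_bit)

lemma uminus_bit_closure: "- x = (x :: bit alg_closure)"
proof -
  have "x + x = 2 * x" by simp
  also have "\<dots> = 0" by (simp only: two_eq_0_bit_closure mult_zero_left)
  finally show ?thesis by (simp add: add_eq_0_iff2)
qed

lemma GF2_add: "x \<in> GF2 m \<Longrightarrow> y \<in> GF2 m \<Longrightarrow> x + y \<in> GF2 m"
  using freshmans_dream'[of "2 ^ m" m x y] by (simp add: GF2_def CHAR_bit)

lemma GF2_mult: "x \<in> GF2 m \<Longrightarrow> y \<in> GF2 m \<Longrightarrow> x * y \<in> GF2 m"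
  by (simp add: GF2_def power_mult_distrib)

lemma GF2_inverse: "x \<in> GF2 m \<Longrightarrow> inverse x \<in> GF2 m"
  by (simp add: GF2_def power_inverse)

lemma ring_of_type_algebra_simps:
  "carrier (ring_of_type_algebra :: 'a :: field ring) = UNIV"
  "\<zero>\<^bsub>ring_of_type_algebra\<^esub> = (0 :: 'a)"
  "\<one>\<^bsub>ring_of_type_algebra\<^esub> = (1 :: 'a)"
  "x \<oplus>\<^bsub>ring_of_type_algebra\<^esub> y = (x + y :: 'a)"
  "x \<otimes>\<^bsub>ring_of_type_algebra\<^esub> y = (x * y :: 'a)"
  by (simp_all add: ring_of_type_algebra_def)

lemma subfield_GF2: "subfield (GF2 m) (ring_of_type_algebra :: bit alg_closure ring)"
proof -
  interpret R: field "ring_of_type_algebra :: bit alg_closure ring"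
    by (rule field_from_type_algebra)
  note [simp] = ring_of_type_algebra_simps
  show ?thesis
  proof (rule R.subfieldI'[OF R.subringI])
    show "\<ominus>\<^bsub>ring_of_type_algebra\<^esub> h \<in> GF2 m" if "h \<in> GF2 m" for h
    proof -
      have "\<ominus>\<^bsub>ring_of_type_algebra\<^esub> h = - h"
        by (rule R.minus_equality) simp_all
      thus ?thesis using that by (simp add: uminus_bit_closure)
    qed
    show "inv\<^bsub>ring_of_type_algebra\<^esub> h \<in> GF2 m"
      if "h \<in> GF2 m - {\<zero>\<^bsub>ring_of_type_algebra\<^esub>}" for h
    proof -
      have "inv\<^bsub>ring_of_type_algebra\<^esub> h = inverse h"
        by (rule R.comm_inv_char) (use that in simp_all)
      thus ?thesis using that by (simp add: GF2_inverse)
    qed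
  qed (auto simp: GF2_add GF2_mult, auto simp: GF2_def)
qed

lemma finite_GF2_card_GF2:
  assumes "m > 0"
  shows   "finite (GF2 m) \<and> card (GF2 m) = 2 ^ m"
proof -
  define q :: nat where "q = 2 ^ m"
  have q: "q > 1" "even q" using assms one_less_power[of "2 :: nat" m] by (auto simp: q_def)
  define p :: "bit alg_closure poly" where "p = Polynomial.monom 1 q - Polynomial.monom 1 1"
  have deg: "Polynomial.degree p = q"
    unfolding p_def using q(1)
    by (subst diff_conv_add_uminus, subst degree_add_eq_left) (auto simp: degree_monom_eq)
  have "p \<noteq> 0" using deg q(1) by auto
  have GF2_eq: "GF2 m = {x. poly p x = 0}"
    by (auto simp: GF2_def p_def poly_monom q_def)
  have "of_nat q = (0 :: bit alg_closure)"
    using q(2) by (auto elim!: evenE simp: two_eq_0_bit_closure)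
  hence pderiv: "pderiv p = - 1"
    by (simp add: p_def pderiv_diff pderiv_monom one_pCons monom_0)
  from alg_closed_imp_factorization[OF \<open>p \<noteq> 0\<close>] obtain A where
    A: "size A = q" "p = smult (Polynomial.lead_coeff p) (\<Prod>x\<in>#A. [:-x, 1:])"
    using deg by auto
  have roots: "poly p x = 0 \<longleftrightarrow> x \<in># A" for x
    using \<open>p \<noteq> 0\<close> by (subst A(2)) (auto simp: poly_prod_mset prod_mset_zero_iff)
  have "count A a = 1" if "a \<in># A" for a
  proof (rule ccontr)
    assume "count A a \<noteq> 1"
    with that obtain B where B: "A = add_mset a (add_mset a B)"
      by (metis One_nat_def count_add_mset count_eq_zero_iff multi_member_split)
    obtain r where "p = [:-a, 1:] * ([:-a, 1:] * r)"
    proof (rule that)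
      show "p = [:-a, 1:] * ([:-a, 1:] *
              smult (Polynomial.lead_coeff p) (\<Prod>x\<in>#B. [:-x, 1:]))"
        by (subst A(2)) (simp only: B image_mset_add_mset prod_mset.add_mset mult_smult_right)
    qed
    hence "poly (pderiv p) a = 0"
      by (simp only: pderiv_mult) simp
    thus False by (simp add: pderiv)
  qed
  hence "size A = card (set_mset A)"
    by (simp add: size_multiset_overloaded_eq)
  thus ?thesis using A(1) by (simp add: GF2_eq roots q_def)
qed

lemma card_GF2: "m > 0 \<Longrightarrow> card (GF2 m) = 2 ^ m"
  using finite_GF2_card_GF2 by blast

lemma GF2_unique:
  assumes "subfield K (ring_of_type_algebra :: bit alg_closure ring)"
    and "card K = 2 ^ m" and "m > 0"
  shows   "K = GF2 m"
proof -
  interpret K: subfield K "ring_of_type_algebra :: bit alg_closure ring" by fact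
  have "finite K" using assms(2) by (intro card_ge_0_finite) simp
  have mult: "x * y \<in> K" if "x \<in> K" "y \<in> K" for x y
    using K.m_closed[OF that] by (simp add: ring_of_type_algebra_simps)
  have "0 \<in> K"
    using subringE(2)[OF K.subring_axioms] by (simp add: ring_of_type_algebra_simps)
  have "x \<in> GF2 m" if "x \<in> K" for x
  proof (cases "x = 0")
    case False
    let ?S = "K - {0}"
    have "(*) x ` ?S = ?S"
      by (rule endo_inj_surj) (use \<open>finite K\<close> False that mult in \<open>auto simp: inj_on_def\<close>)
    hence "\<Prod>?S = \<Prod>((*) x ` ?S)" by simp
    also have "\<dots> = (\<Prod>y\<in>?S. x * y)"
      using False by (subst prod.reindex) (auto simp: inj_on_def)
    also have "\<dots> = x ^ card ?S * \<Prod>?S" by (simp add: prod.distrib)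
    finally have "x ^ card ?S = 1" using \<open>finite K\<close> by auto
    moreover have "2 ^ m = Suc (card ?S)"
      using \<open>0 \<in> K\<close> \<open>finite K\<close> assms(2) card_Suc_Diff1 by metis
    ultimately show ?thesis by (simp add: GF2_def)
  qed (simp add: GF2_def)
  thus ?thesis
    using finite_GF2_card_GF2[OF assms(3)] assms(2) by (intro card_subset_eq) auto
qed

end

theory Submission
  imports Defs
begin

text \<open>
  In even degree a primitive cube root of unity is mapped to \<open>0\<close>, as is \<open>0\<close>.  In odd degree \<open>m\<close>,
  put \<open>y = x + s\<close> with \<open>s = r\<^sup>-\<^sup>2\<close> and \<open>x = s * w\<close>: then \<open>u2\<close> takes the same value at \<open>x\<close> and \<open>y\<close>
  as soon as \<open>w\<^sup>2 + w = 1 + r\<^sup>4 + r\<^sup>5\<close>, which is solvable (by the half-trace) when \<open>r\<^sup>5 + r\<close> has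
  trace \<open>1\<close>.  If no such \<open>r\<close> exists, then the quadratic form \<open>Tr (r\<^sup>5 + r)\<close> vanishes, hence so
  does its polarization \<open>Tr (x\<^sup>4 * y + x * y\<^sup>4)\<close>; as the trace form is nondegenerate, \<open>x\<^sup>1\<^sup>6 = x\<close>
  on the whole field, which forces \<open>m = 1\<close>.
\<close>

section \<open>Arithmetic in characteristic 2 and closure properties of \<open>GF2 m\<close>\<close>

lemma add_self_bit_closure [simp]: "x + x = (0 :: bit alg_closure)"
  using uminus_bit_closure[of x] by (metis add.right_inverse)

lemma add_self_left_bit_closure [simp]: "x + (x + y) = (y :: bit alg_closure)"
  by (simp add: add.assoc[symmetric])

lemma add_eq_0_bit_closure_iff: "x + y = 0 \<longleftrightarrow> x = (y :: bit alg_closure)"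
  by (metis add_eq_0_iff uminus_bit_closure)

lemma frobenius_add: "(x + y :: bit alg_closure) ^ (2 ^ k) = x ^ (2 ^ k) + y ^ (2 ^ k)"
  using freshmans_dream'[of "2 ^ k" k x y] by (simp add: CHAR_bit)

lemma square_add: "(x + y :: bit alg_closure)\<^sup>2 = x\<^sup>2 + y\<^sup>2"
  using frobenius_add[of x y 1] by simp

lemma fourth_power_add: "(x + y :: bit alg_closure) ^ 4 = x ^ 4 + y ^ 4"
  using frobenius_add[of x y 2] by simp

lemma square_sum:
  "(\<Sum>i\<in>A. g i :: bit alg_closure)\<^sup>2 = (\<Sum>i\<in>A. (g i)\<^sup>2)"
  by (induction A rule: infinite_finite_induct) (simp_all add: square_add)

lemma GF2_power: "x \<in> GF2 m \<Longrightarrow> x ^ k \<in> GF2 m"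
  unfolding GF2_def by (simp add: power_mult[symmetric] mult.commute[of k]) (simp add: power_mult)

lemma one_in_GF2: "1 \<in> GF2 m"
  by (simp add: GF2_def)

lemma zero_in_GF2: "0 \<in> GF2 m"
  by (simp add: GF2_def)

lemma GF2_sum: "(\<And>i. i \<in> A \<Longrightarrow> g i \<in> GF2 m) \<Longrightarrow> sum g A \<in> GF2 m"
  by (induction A rule: infinite_finite_induct) (auto intro: GF2_add zero_in_GF2)

lemma GF2_1: "GF2 1 = {0, 1}"
  by (auto simp: GF2_def power2_eq_square)

section \<open>The absolute trace and additive equations over \<open>GF2 m\<close>\<close>

definition trace2 :: "nat \<Rightarrow> bit alg_closure \<Rightarrow> bit alg_closure" where
  "trace2 m x = (\<Sum>i<m. x ^ (2 ^ i))"

lemma trace2_add: "trace2 m (x + y) = trace2 m x + trace2 m y"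
  by (simp add: trace2_def frobenius_add sum.distrib)

lemma trace2_one: "odd m \<Longrightarrow> trace2 m 1 = 1"
  by (auto simp: trace2_def two_eq_0_bit_closure elim!: oddE)

lemma trace2_frobenius: "(trace2 m x)\<^sup>2 = trace2 m (x\<^sup>2)"
  by (simp add: trace2_def square_sum power_mult[symmetric] mult.commute)

text \<open>Squaring permutes the conjugates \<open>x ^ (2 ^ i)\<close> cyclically, because
  \<open>x ^ (2 ^ m) = x\<close> closes the cycle.\<close>

lemma trace2_square:
  assumes "x \<in> GF2 m"
  shows "trace2 m (x\<^sup>2) = trace2 m x"
proof -
  have "x + trace2 m (x\<^sup>2) = (\<Sum>i<Suc m. x ^ (2 ^ i))"
    unfolding sum.lessThan_Suc_shift trace2_def by (simp add: power_mult)
  also have "\<dots> = x + trace2 m x"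
    using assms by (simp add: trace2_def GF2_def add.commute)
  finally show ?thesis by simp
qed

lemma trace2_fourth_power:
  assumes "x \<in> GF2 m"
  shows "trace2 m (x ^ 4) = trace2 m x"
  using trace2_square[OF assms] trace2_square[OF GF2_power[OF assms, of 2]]
  by (simp flip: power_mult)

lemma trace2_cases:
  assumes "x \<in> GF2 m"
  shows "trace2 m x = 0 \<or> trace2 m x = 1"
proof -
  have "(trace2 m x)\<^sup>2 = trace2 m x"
    using assms by (simp add: trace2_frobenius trace2_square)
  thus ?thesis by (auto simp: power2_eq_square)
qed

text \<open>The witness is the half-trace \<open>c + c\<^sup>4 + c\<^sup>1\<^sup>6 + \<dots>\<close>.\<close>

lemma artin_schreier_solvable:
  assumes "odd m" "c \<in> GF2 m" "trace2 m c = 0"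
  obtains w where "w \<in> GF2 m" "w\<^sup>2 + w = c"
proof -
  obtain k where k: "m = 2 * k + 1" using \<open>odd m\<close> by (auto elim: oddE)
  define h where "h n = (\<Sum>i<n. c ^ (4 ^ i))" for n
  \<comment> \<open>The terms of \<open>h n\<close> carry the even exponents of Frobenius, and their
    squares fill in the odd ones.\<close>
  have h: "(h n)\<^sup>2 + h n = (\<Sum>i<2 * n. c ^ (2 ^ i))" for n
  proof (induction n)
    case (Suc n)
    have "(h (Suc n))\<^sup>2 + h (Suc n) = ((h n)\<^sup>2 + h n) + (c ^ (4 ^ n) + (c ^ (4 ^ n))\<^sup>2)"
      by (simp add: h_def square_add algebra_simps)
    also have "c ^ (4 ^ n) = c ^ (2 ^ (2 * n))" by (simp add: power_mult)
    also have "(c ^ (2 ^ (2 * n)))\<^sup>2 = c ^ (2 ^ Suc (2 * n))"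
      by (simp flip: power_mult add: mult.commute)
    finally show ?case by (simp add: Suc.IH add.assoc)
  qed (simp add: h_def)
  \<comment> \<open>With \<open>k + 1\<close> terms the sum runs one step past the trace; the extra
    term \<open>c ^ (2 ^ m)\<close> is \<open>c\<close> itself.\<close>
  have "2 * Suc k = Suc m" using k by simp
  hence "(h (Suc k))\<^sup>2 + h (Suc k) = trace2 m c + c ^ (2 ^ m)"
    by (simp only: h sum.lessThan_Suc trace2_def)
  also have "\<dots> = c" using assms by (simp add: GF2_def)
  finally have "(h (Suc k))\<^sup>2 + h (Suc k) = c" .
  moreover have "h (Suc k) \<in> GF2 m"
    unfolding h_def using assms(2) by (intro GF2_sum GF2_power)
  ultimately show ?thesis using that by blast
qed

text \<open>A nonzero \<open>a\<close> is refuted by the single test value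
  \<open>z = inverse a\<close>, since 1 has trace 1 in odd degree.\<close>

lemma trace2_nondegenerate:
  assumes "odd m" "a \<in> GF2 m" "\<And>z. z \<in> GF2 m \<Longrightarrow> trace2 m (a * z) = 0"
  shows "a = 0"
proof (rule ccontr)
  assume "a \<noteq> 0"
  hence "trace2 m 1 = 0"
    using assms(3)[OF GF2_inverse[OF assms(2)]] by simp
  thus False using trace2_one[OF \<open>odd m\<close>] by simp
qed

lemma GF2_fourth_root:
  assumes "z \<in> GF2 m" "m \<ge> 2"
  obtains y where "y \<in> GF2 m" "y ^ 4 = z"
proof
  \<comment> \<open>The fourth power is Frobenius applied twice; \<open>m - 2\<close> further
    applications complete the identity.\<close>
  show "z ^ (2 ^ (m - 2)) \<in> GF2 m" by (rule GF2_power) fact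
  have "(2::nat) ^ (m - 2) * 4 = 2 ^ m"
    using \<open>m \<ge> 2\<close> by (metis le_add_diff_inverse2 power_add power2_eq_square mult_2 numeral_Bit0)
  thus "(z ^ (2 ^ (m - 2))) ^ 4 = z"
    using assms(1) by (simp add: GF2_def flip: power_mult)
qed

section \<open>The quadratic form \<open>trace2 m (r ^ 5 + r)\<close>\<close>

lemma exists_trace2_eq_1:
  assumes "odd m" "m > 1"
  shows "\<exists>r\<in>GF2 m. trace2 m (r ^ 5 + r) = 1"
proof (rule ccontr)
  assume no_r: "\<not> ?thesis"
  have vanish: "trace2 m (r ^ 5 + r) = 0" if "r \<in> GF2 m" for r
    using trace2_cases[OF GF2_add[OF GF2_power[OF that, of 5] that]] no_r that by blast
  have fixed: "x ^ 16 = x" if x: "x \<in> GF2 m" for x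
  proof -
    have a: "x + x ^ 16 \<in> GF2 m" using x by (intro GF2_add GF2_power)
    have "trace2 m ((x + x ^ 16) * z) = 0" if zm: "z \<in> GF2 m" for z
    proof -
      obtain y where y: "y \<in> GF2 m" and z: "y ^ 4 = z"
        using GF2_fourth_root[OF zm] \<open>m > 1\<close> by (metis Suc_leI Suc_1)
      have pow5: "t ^ 5 = t ^ 4 * t" for t :: "bit alg_closure"
        by (simp add: eval_nat_numeral mult_ac)
      have "(x + y) ^ 5 + (x + y) = (x ^ 5 + x) + (y ^ 5 + y) + (x ^ 4 * y + x * y ^ 4)"
        by (simp add: pow5 fourth_power_add algebra_simps)
      hence "trace2 m ((x + y) ^ 5 + (x + y)) =
          trace2 m (x ^ 5 + x) + trace2 m (y ^ 5 + y) + trace2 m (x ^ 4 * y + x * y ^ 4)"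
        by (simp only: trace2_add)
      hence "trace2 m (x ^ 4 * y + x * y ^ 4) = 0"
        by (simp only: vanish GF2_add x y add_0)
      \<comment> \<open>Trace is invariant under fourth powers, so both terms of the polarization
        become multiples of \<open>y ^ 4 = z\<close>.\<close>
      moreover have "trace2 m (x ^ 4 * y) = trace2 m ((x ^ 4 * y) ^ 4)"
        using x y by (simp add: trace2_fourth_power GF2_mult GF2_power)
      moreover have "(x ^ 4 * y) ^ 4 = x ^ 16 * y ^ 4"
        by (simp add: power_mult_distrib flip: power_mult)
      ultimately have "trace2 m (x ^ 16 * y ^ 4) + trace2 m (x * y ^ 4) = 0"
        by (simp only: trace2_add)
      thus ?thesis
        by (simp only: z distrib_right trace2_add add.commute)
    qed
    from trace2_nondegenerate[OF \<open>odd m\<close> a this] show ?thesis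
      by (simp add: add_eq_0_bit_closure_iff)
  qed
  \<comment> \<open>Counting gives \<open>m \<le> 4\<close>, so oddness leaves only
    \<open>m = 3\<close>, where \<open>x ^ 16 = (x ^ 8) ^ 2 = x ^ 2\<close> would force every
    element into \<open>GF2 1\<close>.\<close>
  hence "GF2 m \<subseteq> GF2 4" by (auto simp: GF2_def)
  hence "card (GF2 m) \<le> card (GF2 4)"
    using finite_GF2_card_GF2[of 4] by (intro card_mono) auto
  hence "(2::nat) ^ m \<le> 2 ^ 4"
    using \<open>m > 1\<close> by (simp only: card_GF2 zero_less_numeral)
  hence "m \<le> 4" by (rule power_le_imp_le_exp[rotated]) simp
  moreover have "m \<noteq> 2" "m \<noteq> 4" using \<open>odd m\<close> by auto
  ultimately have "m = 3" using \<open>m > 1\<close> by linarith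
  have "x ^ 2 = x" if "x \<in> GF2 3" for x
  proof -
    have "x ^ 16 = (x ^ 8) ^ 2" by (simp flip: power_mult)
    moreover have "x ^ 8 = x" using that by (simp add: GF2_def)
    moreover have "x ^ 16 = x" using fixed that \<open>m = 3\<close> by blast
    ultimately show ?thesis by metis
  qed
  hence "GF2 3 \<subseteq> GF2 1" by (auto simp: GF2_def)
  hence "card (GF2 3) \<le> card (GF2 1)"
    using finite_GF2_card_GF2[of 1] by (intro card_mono) auto
  thus False by (simp add: card_GF2)
qed

section \<open>Collisions of \<open>u2\<close> in odd and in even degree\<close>

lemma poly_u2: "poly (map_poly to_ac u2) x = x + x\<^sup>2 + x ^ 6"
proof -
  have "map_poly to_ac u2 = Polynomial.monom 1 1 + Polynomial.monom 1 2 + Polynomial.monom 1 6"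
    by (rule poly_eqI) (simp add: u2_def coeff_map_poly)
  thus ?thesis by (simp add: poly_monom)
qed

text \<open>For \<open>x = s * w\<close> the sixth powers of \<open>x + s\<close> and
  \<open>x\<close> differ by \<open>s ^ 6 * (1 + w + w ^ 2) ^ 2\<close>, which has to equal
  \<open>s + s ^ 2\<close>. Taking \<open>s\<close> to be an inverse square makes
  \<open>(s + s ^ 2) / s ^ 6\<close> the square of \<open>r ^ 4 + r ^ 5\<close>.\<close>

lemma u2_collision:
  fixes r w :: "bit alg_closure"
  assumes "r \<noteq> 0" "w\<^sup>2 + w = 1 + r ^ 4 + r ^ 5"
  defines "s \<equiv> inverse (r\<^sup>2)"
  defines "x \<equiv> s * w"
  shows "(x + s) + (x + s)\<^sup>2 + (x + s) ^ 6 = x + x\<^sup>2 + x ^ 6"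
proof -
  have pow6: "t ^ 6 = t\<^sup>2 * t ^ 4" for t :: "bit alg_closure"
    by (simp flip: power_add)
  have "1 + (w\<^sup>2 + w) = r ^ 4 + r ^ 5"
    using assms(2) by (simp add: add.assoc)
  hence "(1 + (w\<^sup>2 + w))\<^sup>2 = (r ^ 4 + r ^ 5)\<^sup>2" by simp
  hence "1 + (w ^ 4 + w\<^sup>2) = r ^ 8 + r ^ 10"
    by (simp add: square_add flip: power_mult)
  moreover have "s ^ 6 + s ^ 6 * w ^ 4 + s ^ 6 * w\<^sup>2 = s ^ 6 * (1 + (w ^ 4 + w\<^sup>2))"
    by (simp add: algebra_simps)
  ultimately have "s ^ 6 + s ^ 6 * w ^ 4 + s ^ 6 * w\<^sup>2 = s ^ 6 * (r ^ 8 + r ^ 10)"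
    by (simp only:)
  also have "\<dots> = s\<^sup>2 + s"
    using \<open>r \<noteq> 0\<close> by (simp add: s_def field_simps flip: power_mult power_add)
  finally have key: "s ^ 6 + s ^ 6 * w ^ 4 + s ^ 6 * w\<^sup>2 = s\<^sup>2 + s" .
  have "(x + s) ^ 6 = (x\<^sup>2 + s\<^sup>2) * (x ^ 4 + s ^ 4)"
    by (simp only: pow6[of "x + s"] square_add fourth_power_add)
  also have "\<dots> = x\<^sup>2 * x ^ 4 + (s\<^sup>2 * s ^ 4 + s\<^sup>2 * s ^ 4 * w ^ 4 + s\<^sup>2 * s ^ 4 * w\<^sup>2)"
    unfolding x_def power_mult_distrib by (simp only: ring_distribs add_ac mult_ac)
  also have "\<dots> = x ^ 6 + (s ^ 6 + s ^ 6 * w ^ 4 + s ^ 6 * w\<^sup>2)"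
    by (simp only: pow6)
  also have "\<dots> = x ^ 6 + (s\<^sup>2 + s)" by (simp only: key)
  finally show ?thesis by (simp add: square_add algebra_simps)
qed

lemma u2_not_inj_odd:
  assumes "odd m" "m > 1"
  shows "\<not> inj_on (\<lambda>x. poly (map_poly to_ac u2) x) (GF2 m)"
proof -
  obtain r where r: "r \<in> GF2 m" and tr: "trace2 m (r ^ 5 + r) = 1"
    using exists_trace2_eq_1[OF assms] by blast
  have "r \<noteq> 0" using tr by (auto simp: trace2_def power_0_left)
  \<comment> \<open>Here \<open>r ^ 4\<close> has the trace of \<open>r\<close>, and 1 has trace 1
    because \<open>m\<close> is odd.\<close>
  have "trace2 m (1 + r ^ 4 + r ^ 5) = 1 + trace2 m (r ^ 5 + r)"
    using r by (simp add: trace2_add trace2_one[OF \<open>odd m\<close>] trace2_fourth_power algebra_simps)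
  hence "trace2 m (1 + r ^ 4 + r ^ 5) = 0" by (simp only: tr add_self_bit_closure)
  moreover have "1 + r ^ 4 + r ^ 5 \<in> GF2 m"
    using r by (intro GF2_add GF2_power one_in_GF2)
  ultimately obtain w where w: "w \<in> GF2 m" "w\<^sup>2 + w = 1 + r ^ 4 + r ^ 5"
    using artin_schreier_solvable[OF \<open>odd m\<close>] by blast
  define s where "s = inverse (r\<^sup>2)"
  have s: "s \<in> GF2 m" "s \<noteq> 0"
    using r \<open>r \<noteq> 0\<close> by (simp_all add: s_def GF2_inverse GF2_power)
  show ?thesis
  proof
    assume "inj_on (\<lambda>x. poly (map_poly to_ac u2) x) (GF2 m)"
    moreover have "poly (map_poly to_ac u2) (s * w + s) = poly (map_poly to_ac u2) (s * w)"
      unfolding poly_u2 s_def by (rule u2_collision) (fact \<open>r \<noteq> 0\<close> w)+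
    ultimately have "s * w + s = s * w"
      using s w by (blast dest: inj_onD intro: GF2_add GF2_mult)
    thus False using s(2) by simp
  qed
qed

lemma GF2_2_subset_even:
  assumes "even m"
  shows "GF2 2 \<subseteq> GF2 m"
proof
  fix x assume "x \<in> GF2 2"
  hence x: "x ^ 4 = x" by (simp add: GF2_def)
  have "x ^ (4 ^ k) = x" for k by (induction k) (simp_all add: x power_mult)
  thus "x \<in> GF2 m" using \<open>even m\<close> by (auto simp: GF2_def power_mult elim!: evenE)
qed

lemma u2_not_inj_even:
  assumes "even m"
  shows "\<not> inj_on (\<lambda>x. poly (map_poly to_ac u2) x) (GF2 m)"
proof
  assume inj: "inj_on (\<lambda>x. poly (map_poly to_ac u2) x) (GF2 m)"
  \<comment> \<open>Four elements do not fit into two; any element left over is a primitive cube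
    root of unity.\<close>
  have "\<not> GF2 2 \<subseteq> GF2 1"
    using card_mono[of "GF2 1" "GF2 2"] finite_GF2_card_GF2[of 1] card_GF2[of 2] by auto
  then obtain x where x: "x \<in> GF2 2" "x \<noteq> 0" "x \<noteq> 1" unfolding GF2_1 by blast
  have "x * x ^ 3 = x * 1" using x(1) by (simp add: GF2_def eval_nat_numeral)
  hence x3: "x ^ 3 = 1" using x(2) by simp
  have "(x + 1) * (x + x\<^sup>2 + 1) = x ^ 3 + 1"
    by (simp add: algebra_simps eval_nat_numeral)
  hence "x + x\<^sup>2 + 1 = 0" using x3 x(3) by (auto simp: add_eq_0_bit_closure_iff)
  moreover have "x ^ 6 = (x ^ 3)\<^sup>2" by (simp flip: power_mult)
  ultimately have "poly (map_poly to_ac u2) x = poly (map_poly to_ac u2) 0"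
    by (simp add: poly_u2 x3)
  hence "x = 0"
    using inj_onD[OF inj] GF2_2_subset_even[OF assms] x(1) zero_in_GF2 by blast
  thus False using x(2) by simp
qed

theorem theorem6p4:
  shows "permutation_spectrum2 u2 = {1}"
proof -
  \<comment> \<open>On \<open>{0, 1}\<close> the map is the identity, as
    \<open>1 + 1 + 1 = 1\<close>.\<close>
  have "bij_betw (\<lambda>x. poly (map_poly to_ac u2) x) (GF2 1) (GF2 1)"
    unfolding GF2_1 by (auto simp: bij_betw_def inj_on_def poly_u2)
  moreover have "m = 1" if "m > 0" "bij_betw (\<lambda>x. poly (map_poly to_ac u2) x) (GF2 m) (GF2 m)" for m
    using that u2_not_inj_odd[of m] u2_not_inj_even[of m] bij_betw_imp_inj_on[OF that(2)]
    by (cases "m = 1") auto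
  ultimately show ?thesis by (auto simp: permutation_spectrum2_def)
qed

end
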